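(* Let $(X,d)$ be a metric space, let $T:X\to X$ be a self-mapping, and let $r=\inf\{d(Tu,u): Tu\neq u,\ u\in X\}$. If $T$ is a Zamfirescu type $x_0$-mapping with $x_0\in X$ and $d(Tu,x_0)\le r$ for each $u\in D[x_0,r]\setminus\{x_0\}$, then $D[x_0,r]$ is a fixed disc of $T$, that is, $Tu=u$ for all $u\in D[x_0,r]$.
   Context: For $x_0\in X$ and $r\ge 0$, the disc is $D[x_0,r]=\{u\in X: d(u,x_0)\le r\}$. It is called a fixed disc of $T$ if $Tu=u$ for all $u\in D[x_0,r]$. For $x_0\in X$, the self-mapping $T$ is called a Zamfirescu type $x_0$-mapping if there exist $a,b\in[0,1)$ such that for all $u\in X$, $$d(Tu,u)>0\Longrightarrow d(Tu,u)\le \max\left\{a\,d(u,x_0),\ \frac{b}{2}\left[d(Tx_0,u)+d(Tu,x_0)\right]\right\}.$$ *)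

theory Defs
  imports "HOL-Analysis.Abstract_Metric_Spaces"
begin

text \<open>
  The disc \<open>D[x0, r]\<close> of the space \<open>(X, d)\<close> is the library's closed ball \<open>mcball x0 r\<close>.
\<close>

definition (in Metric_space) fixed_disc :: "('a \<Rightarrow> 'a) \<Rightarrow> 'a \<Rightarrow> real \<Rightarrow> bool" where
  "fixed_disc T x0 r \<longleftrightarrow> (\<forall>u \<in> mcball x0 r. T u = u)"

definition (in Metric_space) zamfirescu_type :: "('a \<Rightarrow> 'a) \<Rightarrow> 'a \<Rightarrow> bool" where
  "zamfirescu_type T x0 \<longleftrightarrow>
     (\<exists>a \<in> {0..<1}. \<exists>b \<in> {0..<1}. \<forall>u \<in> M.
        d (T u) u > 0 \<longrightarrow>
        d (T u) u \<le> max (a * d u x0) (b / 2 * (d (T x0) u + d (T u) x0)))"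

text \<open>
  If \<open>T\<close> is the identity on the space, the infimum is taken over the empty set and its value
  in \<^typ>\<open>real\<close> carries no meaning; every disc is then a fixed disc whatever the radius.
\<close>

definition (in Metric_space) displacement_inf :: "('a \<Rightarrow> 'a) \<Rightarrow> real" where
  "displacement_inf T = Inf {d (T u) u | u. u \<in> M \<and> T u \<noteq> u}"

end

theory Submission imports Defs begin

context Metric_space
begin

text \<open>Write r for \<open>displacement_inf T\<close>. A point u of the disc moved by T has
  displacement \<delta> = d (T u) u \<ge> r, by \<open>displacement_inf_le\<close>. The center is
  fixed by \<open>zamfirescu_type_fixes_center\<close>, so the contractive bound involves only d u
  x0 and d (T u) x0, both at most r \<le> \<delta>. Hence \<delta> \<le> max a b * \<delta> <
  \<delta>, which is absurd.\<close>

lemma displacement_inf_le: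
  assumes "u \<in> M" "T u \<noteq> u"
  shows "displacement_inf T \<le> d (T u) u"
  unfolding displacement_inf_def
  by (rule cInf_lower) (use assms in \<open>auto intro!: bdd_belowI[where m = 0]\<close>)

text \<open>At u = x0 the term with a vanishes and the other collapses to b * d (T x0) x0, which is
  too small when b < 1 and the displacement is positive.\<close>

lemma zamfirescu_type_fixes_center:
  assumes T: "T \<in> M \<rightarrow> M" and x0: "x0 \<in> M" and Z: "zamfirescu_type T x0"
  shows "T x0 = x0"
proof (rule ccontr)
  assume "T x0 \<noteq> x0"
  then have pos: "d (T x0) x0 > 0"
    using T x0 by (simp add: Pi_iff)
  with Z x0 obtain a b where b: "b < 1"
    and "d (T x0) x0 \<le> max (a * d x0 x0) (b / 2 * (d (T x0) x0 + d (T x0) x0))"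
    unfolding zamfirescu_type_def by auto
  then have "d (T x0) x0 \<le> b * d (T x0) x0"
    using pos x0 by (auto simp: le_max_iff_disj)
  with pos b show False
    by simp
qed

text \<open>The infimum is only compared with the displacement of a moved point, so its value on the
  empty set never matters.\<close>

lemma zamfirescu_type_fixed_disc:
  assumes T: "T \<in> M \<rightarrow> M" and x0: "x0 \<in> M" and Z: "zamfirescu_type T x0"
    and le: "\<And>u. \<lbrakk>u \<in> mcball x0 (displacement_inf T); u \<noteq> x0\<rbrakk> \<Longrightarrow> d (T u) x0 \<le> displacement_inf T"
  shows "fixed_disc T x0 (displacement_inf T)"
  unfolding fixed_disc_def
proof (intro ballI, rule ccontr)
  fix u assume u: "u \<in> mcball x0 (displacement_inf T)" and neq: "T u \<noteq> u"
  let ?\<delta> = "d (T u) u"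
  have fix0: "T x0 = x0"
    using zamfirescu_type_fixes_center[OF T x0 Z] .
  have uM: "u \<in> M"
    using u by simp
  have pos: "?\<delta> > 0"
    using T uM neq by (simp add: Pi_iff)
  have r: "displacement_inf T \<le> ?\<delta>"
    using displacement_inf_le uM neq .
  have u_le: "d u x0 \<le> ?\<delta>"
    using u r by (simp add: commute)
  \<comment> \<open>The hypothesis \<open>le\<close> excludes the center; u differs from x0 because
    T moves u and fixes x0.\<close>
  have Tu_le: "d (T u) x0 \<le> ?\<delta>"
    using le[OF u] neq fix0 r by fastforce
  obtain a b where ab: "0 \<le> a" "a < 1" "0 \<le> b" "b < 1"
    and contr: "?\<delta> \<le> max (a * d u x0) (b / 2 * (d x0 u + d (T u) x0))"
    using Z uM pos fix0 unfolding zamfirescu_type_def by auto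
  have "a * d u x0 \<le> a * ?\<delta>"
    using u_le ab by (intro mult_left_mono)
  moreover have "b / 2 * (d x0 u + d (T u) x0) \<le> b / 2 * (?\<delta> + ?\<delta>)"
    using u_le Tu_le ab by (intro mult_left_mono add_mono) (auto simp: commute)
  \<comment> \<open>Strictness comes from \<delta> > 0, so both branches of the maximum fall below
    \<delta>.\<close>
  moreover have "a * ?\<delta> < ?\<delta>" "b * ?\<delta> < ?\<delta>"
    using pos ab by simp_all
  ultimately show False
    using contr by simp
qed

end

theorem theorem2p3:
  fixes X :: "'a set" and d :: "'a \<Rightarrow> 'a \<Rightarrow> real" and T :: "'a \<Rightarrow> 'a"
    and x0 :: 'a and r :: real
  assumes "Metric_space X d"
    and "T \<in> X \<rightarrow> X"
    and "r = Metric_space.displacement_inf X d T"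
    and "x0 \<in> X"
    and "Metric_space.zamfirescu_type X d T x0"
    and "\<forall>u \<in> Metric_space.mcball X d x0 r - {x0}. d (T u) x0 \<le> r"
  shows "Metric_space.fixed_disc X d T x0 r"
  using Metric_space.zamfirescu_type_fixed_disc[OF assms(1,2,4,5)] assms(3,6) by simp

end
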